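(* Let $H$ be a universal graph. Let $\mathcal{A}_1$ and $\mathcal{A}_2$ be finite hyperplane arrangements whose intersection posets $L(\mathcal{A}_1)$ and $L(\mathcal{A}_2)$ are not isomorphic as posets. Then $Z_H(L(\mathcal{A}_1))\neq Z_H(L(\mathcal{A}_2))$.
   Context: Undirected graphs are simple. An infinite graph $H$ is universal if it contains every finite graph as an induced subgraph (up to isomorphism). A homomorphism $\varphi:V(G)\to V(H)$ is a map such that $\{u,v\}\in E(G)$ implies $\{\varphi(u),\varphi(v)\}\in E(H)$; $\mathrm{Hom}(G,H)$ is the set of homomorphisms. For a finite graph $G$ with weight function $w:V(G)\to\{1,2,3,\dots\}$ and a graph $H$, with indeterminates $x=\{x_u\}_{u\in V(H)}$, define the formal power series $$X_H(G,w)=\sum_{\varphi\in\mathrm{Hom}(G,H)}\ \prod_{v\in V(G)}x_{\varphi(v)}^{w(v)}.$$ For a finite poset $P$, let $\vec{G}_P$ be the directed graph of its Hasse diagram: the vertex set is $P$, with an arc $u\to v$ exactly when $v$ covers $u$. Let $G_P$ be the undirected graph obtained from $\vec{G}_P$ by forgetting directions, and define $w_P$ on $V(G_P)$ recursively by $w_P(v)=1$ if the in-degree of $v$ in $\vec{G}_P$ is $0$, and $w_P(v)=1+\max_{u:\,u\to v}w_P(u)$ otherwise. Put $Z_H(P)=X_H(G_P,w_P)$. A finite hyperplane arrangement $\mathcal{A}$ is a finite set of affine hyperplanes in a finite-dimensional vector space $V$ over a field. Its intersection poset $L(\mathcal{A})$ is the set of all nonempty intersections of subfamilies of $\mathcal{A}$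 (including $V$ itself as the empty intersection), ordered by reverse inclusion. *)

theory Defs
  imports Complex_Main "HOL-Library.FuncSet" "HOL-Library.Poly_Mapping"
begin

record 'a graph =
  verts :: "'a set"
  edges :: "'a set set"

definition simple_graph :: "'a graph \<Rightarrow> bool" where
  "simple_graph G \<longleftrightarrow> (\<forall>e\<in>edges G. e \<subseteq> verts G \<and> card e = 2)"

text \<open>Every finite graph is isomorphic to one whose vertices are natural numbers, so quantifying
  over graphs on \<^typ>\<open>nat\<close> covers all finite graphs.\<close>

definition universal_graph :: "'h graph \<Rightarrow> bool" where
  "universal_graph H \<longleftrightarrow>
     simple_graph H \<and> infinite (verts H) \<and>
     (\<forall>G :: nat graph. simple_graph G \<and> finite (verts G) \<longrightarrow>
        (\<exists>f. inj_on f (verts G) \<and> f ` verts G \<subseteq> verts H \<and>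
             (\<forall>u\<in>verts G. \<forall>v\<in>verts G. {u, v} \<in> edges G \<longleftrightarrow> {f u, f v} \<in> edges H)))"

text \<open>Homomorphisms are taken to be extensional, so that distinct elements of \<open>Hom G H\<close>
  are distinct as maps on the vertices of \<open>G\<close>.\<close>

definition Hom :: "'g graph \<Rightarrow> 'h graph \<Rightarrow> ('g \<Rightarrow> 'h) set" where
  "Hom G H = {\<phi> \<in> verts G \<rightarrow>\<^sub>E verts H. \<forall>u v. {u, v} \<in> edges G \<longrightarrow> {\<phi> u, \<phi> v} \<in> edges H}"

text \<open>A monomial in the indeterminates \<open>x\<^sub>u\<close> is its finitely supported exponent function, and a
  formal power series is the function that sends a monomial to its coefficient.\<close>

type_synonym 'h power_series = "('h \<Rightarrow>\<^sub>0 nat) \<Rightarrow> int"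

definition hom_monomial :: "'g graph \<Rightarrow> ('g \<Rightarrow> nat) \<Rightarrow> ('g \<Rightarrow> 'h) \<Rightarrow> ('h \<Rightarrow>\<^sub>0 nat)" where
  "hom_monomial G w \<phi> = (\<Sum>v\<in>verts G. Poly_Mapping.single (\<phi> v) (w v))"

definition X_series :: "'h graph \<Rightarrow> 'g graph \<Rightarrow> ('g \<Rightarrow> nat) \<Rightarrow> 'h power_series" where
  "X_series H G w = (\<lambda>m. int (card {\<phi> \<in> Hom G H. hom_monomial G w \<phi> = m}))"

text \<open>The cardinality above is never that of an infinite set.\<close>

lemma finite_Hom_monomial:
  assumes "finite (verts G)" and "\<And>v. v \<in> verts G \<Longrightarrow> w v \<ge> 1"
  shows "finite {\<phi> \<in> Hom G H. hom_monomial G w \<phi> = m}"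
proof (rule finite_subset)
  show "finite (verts G \<rightarrow>\<^sub>E Poly_Mapping.keys m)"
    using assms(1) by (intro finite_PiE) auto
  show "{\<phi> \<in> Hom G H. hom_monomial G w \<phi> = m} \<subseteq> verts G \<rightarrow>\<^sub>E Poly_Mapping.keys m"
  proof
    fix \<phi> assume "\<phi> \<in> {\<phi> \<in> Hom G H. hom_monomial G w \<phi> = m}"
    then have \<phi>: "\<phi> \<in> Hom G H" and m: "hom_monomial G w \<phi> = m" by auto
    have "\<phi> v \<in> Poly_Mapping.keys m" if v: "v \<in> verts G" for v
    proof -
      have "Poly_Mapping.lookup m (\<phi> v)
          = (\<Sum>u\<in>verts G. Poly_Mapping.lookup (Poly_Mapping.single (\<phi> u) (w u)) (\<phi> v))"
        unfolding m[symmetric] hom_monomial_def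
        by (simp add: lookup_sum)
      also have "\<dots> \<ge> Poly_Mapping.lookup (Poly_Mapping.single (\<phi> v) (w v)) (\<phi> v)"
        using v assms(1) by (intro member_le_sum) auto
      finally show ?thesis
        using assms(2)[OF v] by (auto simp: in_keys_iff)
    qed
    with \<phi> show "\<phi> \<in> verts G \<rightarrow>\<^sub>E Poly_Mapping.keys m"
      by (auto simp: Hom_def PiE_iff)
  qed
qed

text \<open>A poset is given by its carrier \<open>P\<close> and order relation \<open>r\<close> with
  \<^term>\<open>partial_order_on P r\<close>.\<close>

definition poset_isomorphic :: "'a set \<Rightarrow> 'a rel \<Rightarrow> 'b set \<Rightarrow> 'b rel \<Rightarrow> bool" where
  "poset_isomorphic P r Q s \<longleftrightarrow>
     (\<exists>f. bij_betw f P Q \<and> (\<forall>x\<in>P. \<forall>y\<in>P. (x, y) \<in> r \<longleftrightarrow> (f x, f y) \<in> s))"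

definition hasse_arc :: "'a set \<Rightarrow> 'a rel \<Rightarrow> 'a \<Rightarrow> 'a \<Rightarrow> bool" where
  "hasse_arc P r u v \<longleftrightarrow>
     u \<in> P \<and> v \<in> P \<and> u \<noteq> v \<and> (u, v) \<in> r \<and>
     \<not> (\<exists>z\<in>P. z \<noteq> u \<and> z \<noteq> v \<and> (u, z) \<in> r \<and> (z, v) \<in> r)"

definition hasse_graph :: "'a set \<Rightarrow> 'a rel \<Rightarrow> 'a graph" where
  "hasse_graph P r = \<lparr>verts = P, edges = {{u, v} | u v. hasse_arc P r u v}\<rparr>"

text \<open>The recursion terminates when \<open>P\<close> is a finite poset, see \<open>hasse_weight_eq\<close> below.\<close>

function (domintros) hasse_weight :: "'a set \<Rightarrow> 'a rel \<Rightarrow> 'a \<Rightarrow> nat" where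
  "hasse_weight P r v =
     (if {u. hasse_arc P r u v} = {} then 1
      else 1 + Max (hasse_weight P r ` {u. hasse_arc P r u v}))"
  by auto

definition Z_series :: "'h graph \<Rightarrow> 'a set \<Rightarrow> 'a rel \<Rightarrow> 'h power_series" where
  "Z_series H P r = X_series H (hasse_graph P r) (hasse_weight P r)"

lemma hasse_weight_dom:
  assumes "finite P" and "partial_order_on P r"
  shows "hasse_weight_dom (P, r, v)"
proof -
  let ?R = "{(u, v). hasse_arc P r u v}"
  have sub: "?R \<subseteq> r - Id" by (auto simp: hasse_arc_def)
  have "trans r" "antisym r"
    using assms(2) by (auto simp: partial_order_on_def preorder_on_def)
  then have "trans (r - Id)" by (rule trans_diff_Id)
  then have "acyclic (r - Id)" by (simp add: acyclic_irrefl irrefl_def)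
  then have "acyclic ?R" using sub by (rule acyclic_subset)
  moreover have "finite ?R"
    by (rule finite_subset[of _ "P \<times> P"]) (use assms(1) in \<open>auto simp: hasse_arc_def\<close>)
  ultimately have "wf ?R" by (simp add: finite_acyclic_wf)
  then show ?thesis
  proof (induction v rule: wf_induct_rule)
    case (less v)
    show ?case by (rule hasse_weight.domintros) (use less in auto)
  qed
qed

lemma hasse_weight_eq:
  assumes "finite P" and "partial_order_on P r"
  shows "hasse_weight P r v =
     (if {u. hasse_arc P r u v} = {} then 1
      else 1 + Max (hasse_weight P r ` {u. hasse_arc P r u v}))"
  by (rule hasse_weight.psimps[OF hasse_weight_dom[OF assms]])

definition affine_hyperplane :: "('k::field \<Rightarrow> 'v::ab_group_add \<Rightarrow> 'v) \<Rightarrow> 'v set \<Rightarrow> bool" where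
  "affine_hyperplane scale S \<longleftrightarrow>
     (\<exists>a W. module.subspace scale W \<and>
            vector_space.dim scale W + 1 = vector_space.dim scale (UNIV :: 'v set) \<and>
            S = (+) a ` W)"

definition finite_arrangement ::
    "('k::field \<Rightarrow> 'v::ab_group_add \<Rightarrow> 'v) \<Rightarrow> 'v set set \<Rightarrow> bool" where
  "finite_arrangement scale \<A> \<longleftrightarrow> finite \<A> \<and> (\<forall>S\<in>\<A>. affine_hyperplane scale S)"

text \<open>The ambient space is the whole type, hence \<^term>\<open>\<Inter>{}\<close> is the ambient space.\<close>

definition intersection_poset :: "'v set set \<Rightarrow> 'v set set" where
  "intersection_poset \<A> = {\<Inter>\<B> | \<B>. \<B> \<subseteq> \<A> \<and> \<Inter>\<B> \<noteq> {}}"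

definition intersection_order :: "'v set set \<Rightarrow> 'v set rel" where
  "intersection_order \<A> =
     {(X, Y). X \<in> intersection_poset \<A> \<and> Y \<in> intersection_poset \<A> \<and> Y \<subseteq> X}"

lemma finite_intersection_poset: "finite \<A> \<Longrightarrow> finite (intersection_poset \<A>)"
  by (rule finite_subset[of _ "Inter ` Pow \<A>"]) (auto simp: intersection_poset_def)

lemma partial_order_intersection_order:
  "partial_order_on (intersection_poset \<A>) (intersection_order \<A>)"
  by (auto simp: partial_order_on_def preorder_on_def refl_on_def intersection_order_def
      intro!: transI antisymI)

end

theory Submission
  imports Defs
begin

text \<open>
  Embed \<open>G\<^sub>1\<close> into \<open>H\<close> as an induced subgraph. The monomial of this embedding also occurs in the
  series of \<open>G\<^sub>2\<close>, so some homomorphism of \<open>G\<^sub>2\<close> maps onto the embedded copy of \<open>G\<^sub>1\<close>, with the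
  weights in each fibre adding up to the weight below. Having such surjections in both directions
  makes the numbers of vertices and of edges agree, so the surjection is an isomorphism of weighted
  graphs. In a Hasse diagram weights strictly increase along arcs, so the weights restore the
  directions and hence the order.
\<close>

section \<open>Finite simple graphs inside a universal graph\<close>

lemma simple_graphD:
  assumes "simple_graph G" and "{u, v} \<in> edges G"
  shows "u \<in> verts G" "v \<in> verts G" "u \<noteq> v"
proof -
  have "{u, v} \<subseteq> verts G" "card {u, v} = 2"
    using assms unfolding simple_graph_def by blast+
  then show "u \<in> verts G" "v \<in> verts G" "u \<noteq> v" by auto
qed

lemma simple_graph_edgeE:
  assumes "simple_graph G" and "e \<in> edges G"
  obtains u v where "e = {u, v}" "u \<in> verts G" "v \<in> verts G" "u \<noteq> v"
proof -
  have "card e = 2" "e \<subseteq> verts G"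
    using assms unfolding simple_graph_def by blast+
  then show ?thesis
    using that by (auto simp: card_2_iff)
qed

text \<open>Universality speaks only of graphs on \<open>nat\<close>, so \<open>G\<close> is first
  relabelled along an injection of its finite vertex set into \<open>nat\<close>; the embedding is
  that injection followed by the one that universality supplies.\<close>

lemma universal_graph_embeds:
  fixes G :: "'g graph"
  assumes H: "universal_graph H" and G: "simple_graph G" "finite (verts G)"
  obtains f where "inj_on f (verts G)" and "f ` verts G \<subseteq> verts H"
    and "\<And>u v. u \<in> verts G \<Longrightarrow> v \<in> verts G \<Longrightarrow> {u, v} \<in> edges G \<longleftrightarrow> {f u, f v} \<in> edges H"
proof -
  obtain e :: "'g \<Rightarrow> nat" where e: "inj_on e (verts G)"
    using finite_imp_inj_to_nat_seg[OF G(2)] by blast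
  define N where "N = \<lparr>verts = e ` verts G, edges = (`) e ` edges G\<rparr>"
  have "card (e ` s) = card s" if "s \<in> edges G" for s
    using that G(1) by (intro card_image inj_on_subset[OF e]) (auto simp: simple_graph_def)
  then have "simple_graph N" "finite (verts N)"
    using G by (auto simp: simple_graph_def N_def)
  then obtain f where f: "inj_on f (verts N)" "f ` verts N \<subseteq> verts H"
    "\<And>u v. u \<in> verts N \<Longrightarrow> v \<in> verts N \<Longrightarrow> {u, v} \<in> edges N \<longleftrightarrow> {f u, f v} \<in> edges H"
    using H unfolding universal_graph_def by meson
  have N_edge: "{e u, e v} \<in> edges N \<longleftrightarrow> {u, v} \<in> edges G"
    if uv: "u \<in> verts G" "v \<in> verts G" for u v
  proof
    assume "{e u, e v} \<in> edges N"
    then obtain s where s: "s \<in> edges G" "e ` {u, v} = e ` s"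
      by (auto simp: N_def)
    moreover have "s \<subseteq> verts G"
      using s(1) G(1) by (auto simp: simple_graph_def)
    ultimately have "{u, v} = s"
      using inj_on_image_eq_iff[OF e, of "{u, v}" s] uv by simp
    with s show "{u, v} \<in> edges G" by simp
  next
    assume "{u, v} \<in> edges G"
    then show "{e u, e v} \<in> edges N"
      by (auto simp: N_def intro!: image_eqI[where x = "{u, v}"])
  qed
  show ?thesis
  proof (rule that[of "f \<circ> e"])
    show "inj_on (f \<circ> e) (verts G)"
      using e f(1) by (auto simp: N_def intro: comp_inj_on)
    show "(f \<circ> e) ` verts G \<subseteq> verts H"
      using f(2) by (auto simp: N_def)
    show "{u, v} \<in> edges G \<longleftrightarrow> {(f \<circ> e) u, (f \<circ> e) v} \<in> edges H"
      if "u \<in> verts G" "v \<in> verts G" for u v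
      using f(3)[of "e u" "e v"] N_edge[OF that] that by (simp add: N_def)
  qed
qed

section \<open>From equal series to weighted surjections\<close>

lemma lookup_hom_monomial:
  assumes "finite (verts G)"
  shows "Poly_Mapping.lookup (hom_monomial G w \<phi>) x = (\<Sum>v | v \<in> verts G \<and> \<phi> v = x. w v)"
  using assms by (simp add: hom_monomial_def lookup_sum lookup_single when_def sum.inter_filter)

text \<open>The exponent of an indeterminate is the total weight of a fibre. Positive weights make
  it nonzero exactly when the fibre is nonempty, so the monomial determines the image of the
  homomorphism.\<close>

lemma keys_hom_monomial:
  assumes "finite (verts G)" and "\<And>v. v \<in> verts G \<Longrightarrow> w v \<ge> 1"
  shows "Poly_Mapping.keys (hom_monomial G w \<phi>) = \<phi> ` verts G"
proof -
  have "w v > 0" if "v \<in> verts G" for v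
    using assms(2)[OF that] by simp
  then show ?thesis
    using assms(1) by (fastforce simp: in_keys_iff lookup_hom_monomial)
qed

text \<open>This is what a comparison of two monomials yields: the sum condition equates exponents.
  Edges of \<open>G'\<close> may fail to be images of edges of \<open>G\<close>; surjectivity is
  asked on vertices only.\<close>

definition weighted_quotient_map ::
    "'a graph \<Rightarrow> ('a \<Rightarrow> nat) \<Rightarrow> 'b graph \<Rightarrow> ('b \<Rightarrow> nat) \<Rightarrow> ('a \<Rightarrow> 'b) \<Rightarrow> bool" where
  "weighted_quotient_map G w G' w' \<psi> \<longleftrightarrow>
     \<psi> ` verts G = verts G' \<and>
     (\<forall>u v. {u, v} \<in> edges G \<longrightarrow> {\<psi> u, \<psi> v} \<in> edges G') \<and>
     (\<forall>x\<in>verts G'. w' x = (\<Sum>v | v \<in> verts G \<and> \<psi> v = x. w v))"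

lemma X_series_eq_imp_weighted_quotient_map:
  assumes H: "universal_graph H"
    and G: "simple_graph G" "finite (verts G)" "\<And>v. v \<in> verts G \<Longrightarrow> w v \<ge> 1"
    and G': "simple_graph G'" "finite (verts G')" "\<And>v. v \<in> verts G' \<Longrightarrow> w' v \<ge> 1"
    and eq: "X_series H G w = X_series H G' w'"
  obtains \<psi> where "weighted_quotient_map G w G' w' \<psi>"
proof -
  obtain f where inj: "inj_on f (verts G')" and sub: "f ` verts G' \<subseteq> verts H"
    and edge: "\<And>u v. u \<in> verts G' \<Longrightarrow> v \<in> verts G' \<Longrightarrow> {u, v} \<in> edges G' \<longleftrightarrow> {f u, f v} \<in> edges H"
    using universal_graph_embeds[OF H G'(1,2)] by metis
  \<comment> \<open>\<open>Hom\<close> contains extensional functions only, hence the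
    restriction.\<close>
  define F where "F = restrict f (verts G')"
  define m where "m = hom_monomial G' w' F"
  have "F \<in> Hom G' H"
    unfolding Hom_def
  proof (intro CollectI conjI allI impI)
    show "F \<in> verts G' \<rightarrow>\<^sub>E verts H"
      using sub by (auto simp: F_def)
    show "{F u, F v} \<in> edges H" if "{u, v} \<in> edges G'" for u v
      using that edge[of u v] simple_graphD[OF G'(1) that] by (simp add: F_def)
  qed
  then have "{\<phi> \<in> Hom G' H. hom_monomial G' w' \<phi> = m} \<noteq> {}"
    by (auto simp: m_def)
  \<comment> \<open>Finiteness matters here, because \<open>card\<close> of an infinite set is 0.
    Coefficients are counts, so nothing can cancel the contribution of \<open>F\<close>.\<close>
  then have "card {\<phi> \<in> Hom G' H. hom_monomial G' w' \<phi> = m} \<noteq> 0"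
    using finite_Hom_monomial[OF G'(2,3)] by (simp add: card_eq_0_iff)
  then have "card {\<phi> \<in> Hom G H. hom_monomial G w \<phi> = m} \<noteq> 0"
    using fun_cong[OF eq, of m] by (simp add: X_series_def)
  then obtain \<phi> where \<phi>: "\<phi> \<in> Hom G H" "hom_monomial G w \<phi> = m"
    by (metis (mono_tags, lifting) card.empty empty_Collect_eq)
  \<comment> \<open>\<open>F\<close> and \<open>\<phi>\<close> have the same monomial
    \<open>m\<close>, and its support is the image of each.\<close>
  have onto: "\<phi> ` verts G = f ` verts G'"
    using keys_hom_monomial[of G w \<phi>, OF G(2,3)] keys_hom_monomial[of G' w' F, OF G'(2,3)] \<phi>(2)
    by (simp add: m_def F_def cong: image_cong)
  define g where "g = the_inv_into (verts G') f"
  have gf: "g (f x) = x" if "x \<in> verts G'" for x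
    using that inj by (simp add: g_def the_inv_into_f_f)
  have \<phi>_img: "g (\<phi> v) \<in> verts G'" "f (g (\<phi> v)) = \<phi> v" if "v \<in> verts G" for v
    using onto that gf by (metis image_iff)+
  have "weighted_quotient_map G w G' w' (g \<circ> \<phi>)"
    unfolding weighted_quotient_map_def
  proof (intro conjI allI impI ballI)
    show "(g \<circ> \<phi>) ` verts G = verts G'"
      using onto gf by (force simp: image_iff set_eq_iff)
    \<comment> \<open>The embedding is induced: the edge of \<open>H\<close> between
      \<open>\<phi> u\<close> and \<open>\<phi> v\<close> joins two embedded vertices, so it comes
      from an edge of \<open>G'\<close>.\<close>
    show "{(g \<circ> \<phi>) u, (g \<circ> \<phi>) v} \<in> edges G'" if uv: "{u, v} \<in> edges G" for u v
      using \<phi>(1) uv edge[of "g (\<phi> u)" "g (\<phi> v)"] simple_graphD[OF G(1) uv]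
      by (simp add: \<phi>_img Hom_def)
    fix x assume x: "x \<in> verts G'"
    \<comment> \<open>With a one-point fibre, the exponent of \<open>m\<close> at \<open>f x\<close>
      is just \<open>w' x\<close>; computed from \<open>\<phi>\<close>, the same exponent is the
      fibre sum.\<close>
    have "{v \<in> verts G'. F v = f x} = {x}"
      using x inj by (auto simp: F_def dest: inj_onD)
    then have "w' x = Poly_Mapping.lookup m (f x)"
      by (simp add: m_def lookup_hom_monomial[OF G'(2)])
    also have "\<dots> = (\<Sum>v | v \<in> verts G \<and> \<phi> v = f x. w v)"
      by (simp add: \<phi>(2)[symmetric] lookup_hom_monomial[OF G(2)])
    also have "{v. v \<in> verts G \<and> \<phi> v = f x} = {v. v \<in> verts G \<and> (g \<circ> \<phi>) v = x}"
      using x gf \<phi>_img by auto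
    finally show "w' x = (\<Sum>v | v \<in> verts G \<and> (g \<circ> \<phi>) v = x. w v)" .
  qed
  then show ?thesis by (rule that)
qed

section \<open>Surjections in both directions\<close>

lemma finite_edges:
  assumes "simple_graph G" and "finite (verts G)"
  shows "finite (edges G)"
  by (rule finite_subset[of _ "Pow (verts G)"]) (use assms in \<open>auto simp: simple_graph_def\<close>)

lemma weighted_quotient_map_card_verts_le:
  assumes "finite (verts G)" and "weighted_quotient_map G w G' w' \<psi>"
  shows "card (verts G') \<le> card (verts G)"
  using card_image_le[OF assms(1), of \<psi>] assms(2) by (simp add: weighted_quotient_map_def)

lemma weighted_quotient_map_image_edges:
  assumes "simple_graph G" and "weighted_quotient_map G w G' w' \<psi>"
  shows "(`) \<psi> ` edges G \<subseteq> edges G'"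
proof (intro image_subsetI)
  fix e assume e: "e \<in> edges G"
  then obtain u v where "e = {u, v}"
    using assms(1) by (elim simple_graph_edgeE)
  then show "\<psi> ` e \<in> edges G'"
    using e assms(2) by (simp add: weighted_quotient_map_def)
qed

lemma inj_on_image_edges:
  assumes "simple_graph G" and "inj_on \<psi> (verts G)"
  shows "inj_on ((`) \<psi>) (edges G)"
  by (rule inj_on_subset[OF inj_on_image_Pow[OF assms(2)]])
    (use assms(1) in \<open>auto simp: simple_graph_def\<close>)

text \<open>The map \<open>\<psi>'\<close> need not be inverse to \<open>\<psi>\<close>; it serves
  to bound cardinalities. Equally many vertices make both surjections injective, and then both act
  injectively on edges. Fibres of \<open>\<psi>\<close> are single points, so the weight sums have
  one term.\<close>

lemma mutual_weighted_quotient_maps_imp_isomorphism: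
  assumes G: "simple_graph G" "finite (verts G)"
    and G': "simple_graph G'" "finite (verts G')"
    and \<psi>: "weighted_quotient_map G w G' w' \<psi>"
    and \<psi>': "weighted_quotient_map G' w' G w \<psi>'"
  shows "bij_betw \<psi> (verts G) (verts G')"
    and "\<And>u v. u \<in> verts G \<Longrightarrow> v \<in> verts G \<Longrightarrow> {u, v} \<in> edges G \<longleftrightarrow> {\<psi> u, \<psi> v} \<in> edges G'"
    and "\<And>v. v \<in> verts G \<Longrightarrow> w' (\<psi> v) = w v"
proof -
  have onto: "\<psi> ` verts G = verts G'" "\<psi>' ` verts G' = verts G"
    using \<psi> \<psi>' by (auto simp: weighted_quotient_map_def)
  have "card (verts G) = card (verts G')"
    using weighted_quotient_map_card_verts_le[OF G(2) \<psi>]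
      weighted_quotient_map_card_verts_le[OF G'(2) \<psi>'] by simp
  then have inj: "inj_on \<psi> (verts G)" "inj_on \<psi>' (verts G')"
    using onto G(2) G'(2) by (auto intro!: eq_card_imp_inj_on)
  then show "bij_betw \<psi> (verts G) (verts G')"
    using onto by (simp add: bij_betw_def)
  note E = weighted_quotient_map_image_edges[OF G(1) \<psi>] weighted_quotient_map_image_edges[OF G'(1) \<psi>']
  note injE = inj_on_image_edges[OF G(1) inj(1)] inj_on_image_edges[OF G'(1) inj(2)]
  \<comment> \<open>\<open>\<psi>'\<close> injects the edges of \<open>G'\<close> into those of
    \<open>G\<close>. Since \<open>\<psi>\<close> injects the other way, its image is a subset of
    the finite set \<open>edges G'\<close> of full size.\<close>
  have "card (edges G') \<le> card (edges G)"
    by (rule card_inj_on_le[OF injE(2) E(2) finite_edges[OF G]])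
  then have edges_onto: "(`) \<psi> ` edges G = edges G'"
    using card_seteq[OF finite_edges[OF G'] E(1)] card_image[OF injE(1)] by simp
  show "{u, v} \<in> edges G \<longleftrightarrow> {\<psi> u, \<psi> v} \<in> edges G'" if uv: "u \<in> verts G" "v \<in> verts G" for u v
  proof
    assume "{\<psi> u, \<psi> v} \<in> edges G'"
    then obtain s where s: "s \<in> edges G" "\<psi> ` {u, v} = \<psi> ` s"
      using edges_onto by auto
    moreover have "s \<subseteq> verts G"
      using s(1) G(1) by (auto simp: simple_graph_def)
    ultimately have "{u, v} = s"
      using inj_on_image_eq_iff[OF inj(1), of "{u, v}" s] uv by simp
    with s show "{u, v} \<in> edges G" by simp
  qed (use \<psi> in \<open>auto simp: weighted_quotient_map_def\<close>)
  show "w' (\<psi> v) = w v" if v: "v \<in> verts G" for v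
  proof -
    have "{u. u \<in> verts G \<and> \<psi> u = \<psi> v} = {v}"
      using v inj(1) by (auto dest: inj_onD)
    moreover have "\<psi> v \<in> verts G'"
      using v onto by auto
    ultimately show ?thesis
      using \<psi> by (simp add: weighted_quotient_map_def)
  qed
qed

section \<open>Recovering a finite poset from its weighted Hasse graph\<close>

lemma simple_graph_hasse_graph: "simple_graph (hasse_graph P r)"
  by (auto simp: simple_graph_def hasse_graph_def hasse_arc_def)

lemma hasse_weight_ge_1:
  assumes "finite P" and "partial_order_on P r"
  shows "hasse_weight P r v \<ge> 1"
  by (subst hasse_weight_eq[OF assms]) simp

lemma hasse_weight_less:
  assumes "finite P" and "partial_order_on P r" and "hasse_arc P r u v"
  shows "hasse_weight P r u < hasse_weight P r v"
proof -
  have "finite {u. hasse_arc P r u v}"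
    by (rule finite_subset[OF _ assms(1)]) (auto simp: hasse_arc_def)
  then have "hasse_weight P r u \<le> Max (hasse_weight P r ` {u. hasse_arc P r u v})"
    using assms(3) by (intro Max_ge) auto
  then show ?thesis
    using assms(3) by (subst (2) hasse_weight_eq[OF assms(1,2)]) auto
qed

text \<open>An edge comes from an arc in one of two directions, and the wrong direction would
  reverse the strict inequality of weights.\<close>

lemma hasse_arc_iff_edge_and_weight:
  assumes "finite P" and "partial_order_on P r"
  shows "hasse_arc P r u v \<longleftrightarrow>
    {u, v} \<in> edges (hasse_graph P r) \<and> hasse_weight P r u < hasse_weight P r v"
  using hasse_weight_less[OF assms, of u v] hasse_weight_less[OF assms, of v u]
  by (auto simp: hasse_graph_def doubleton_eq_iff)

text \<open>Induction on the size of the interval from \<open>x\<close> to \<open>y\<close>: unless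
  \<open>x = y\<close> or \<open>y\<close> covers \<open>x\<close>, an element \<open>z\<close>
  strictly between them splits it into two smaller intervals.\<close>

lemma order_imp_hasse_arc_rtranclp:
  assumes "finite P" and "partial_order_on P r" and "x \<in> P" and "y \<in> P" and "(x, y) \<in> r"
  shows "(hasse_arc P r)\<^sup>*\<^sup>* x y"
  using assms(3-5)
proof (induction "card {z \<in> P. (x, z) \<in> r \<and> (z, y) \<in> r}" arbitrary: x y rule: less_induct)
  case less
  have r: "refl_on P r" "trans r" "antisym r"
    using assms(2) by (auto simp: partial_order_on_def preorder_on_def)
  let ?I = "\<lambda>x y. {z \<in> P. (x, z) \<in> r \<and> (z, y) \<in> r}"
  consider "x = y" | "hasse_arc P r x y"
    | z where "z \<in> P" "z \<noteq> x" "z \<noteq> y" "(x, z) \<in> r" "(z, y) \<in> r"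
    using less.prems by (auto simp: hasse_arc_def)
  then show ?case
  proof cases
    case 3
    have "?I x z \<subseteq> ?I x y" "?I z y \<subseteq> ?I x y"
      using 3(4,5) transD[OF r(2)] by blast+
    \<comment> \<open>Each subinterval loses an endpoint: by antisymmetry, membership would force
      \<open>y = z\<close> or \<open>x = z\<close>.\<close>
    moreover have "y \<notin> ?I x z" "x \<notin> ?I z y"
      using 3(2-5) antisymD[OF r(3)] by blast+
    moreover have "y \<in> ?I x y" "x \<in> ?I x y"
      using less.prems refl_onD[OF r(1)] by auto
    ultimately have "?I x z \<subset> ?I x y" "?I z y \<subset> ?I x y"
      by blast+
    then have "card (?I x z) < card (?I x y)" "card (?I z y) < card (?I x y)"
      using assms(1) by (auto intro!: psubset_card_mono)
    then have "(hasse_arc P r)\<^sup>*\<^sup>* x z" "(hasse_arc P r)\<^sup>*\<^sup>* z y"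
      using less.hyps 3 less.prems by auto
    then show ?thesis by (rule rtranclp_trans)
  qed auto
qed

lemma hasse_arc_rtranclp_imp_order:
  assumes "partial_order_on P r" and "(hasse_arc P r)\<^sup>*\<^sup>* x y" and "x \<in> P"
  shows "(x, y) \<in> r"
  using assms(2)
proof (induction rule: rtranclp_induct)
  case base
  show ?case
    using assms(1,3) by (auto simp: partial_order_on_def preorder_on_def dest: refl_onD)
next
  case (step y z)
  then show ?case
    using assms(1) by (auto simp: partial_order_on_def preorder_on_def hasse_arc_def dest: transD)
qed

text \<open>The image of a chain of covers is a chain of covers. Stated as a one-way implication,
  this can be applied both to a bijection and to its inverse.\<close>

lemma hasse_arc_preserving_imp_monotone:
  assumes "finite P" "partial_order_on P r" "partial_order_on Q s"
    and arc: "\<And>u v. hasse_arc P r u v \<Longrightarrow> hasse_arc Q s (f u) (f v)"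
    and "f ` P \<subseteq> Q" "x \<in> P" "y \<in> P" "(x, y) \<in> r"
  shows "(f x, f y) \<in> s"
proof (rule hasse_arc_rtranclp_imp_order[OF assms(3)])
  show "f x \<in> Q" using assms by auto
  show "(hasse_arc Q s)\<^sup>*\<^sup>* (f x) (f y)"
    using order_imp_hasse_arc_rtranclp[OF assms(1,2,6-8)]
    by (induction rule: rtranclp_induct) (auto intro: rtranclp.rtrancl_into_rtrancl arc)
qed

lemma hasse_arc_isomorphism_imp_poset_isomorphic:
  assumes P: "finite P" "partial_order_on P r" and Q: "finite Q" "partial_order_on Q s"
    and f: "bij_betw f P Q"
    and arc: "\<And>u v. u \<in> P \<Longrightarrow> v \<in> P \<Longrightarrow> hasse_arc P r u v \<longleftrightarrow> hasse_arc Q s (f u) (f v)"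
  shows "poset_isomorphic P r Q s"
  unfolding poset_isomorphic_def
proof (intro exI conjI ballI)
  show "bij_betw f P Q" by (rule f)
  fix x y assume xy: "x \<in> P" "y \<in> P"
  let ?g = "the_inv_into P f"
  have fQ: "f ` P = Q" and inj: "inj_on f P" using f by (auto simp: bij_betw_def)
  have gP: "?g ` Q = P" using fQ inj the_inv_into_onto by blast
  show "(x, y) \<in> r \<longleftrightarrow> (f x, f y) \<in> s"
  proof
    assume "(x, y) \<in> r"
    then show "(f x, f y) \<in> s"
      using fQ arc xy
      by (intro hasse_arc_preserving_imp_monotone[OF P Q(2)]) (auto simp: hasse_arc_def)
  next
    have *: "hasse_arc P r (?g u) (?g v)" if "hasse_arc Q s u v" for u v
    proof -
      have "u \<in> Q" "v \<in> Q" using that by (auto simp: hasse_arc_def)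
      then have "f (?g u) = u" "f (?g v) = v" "?g u \<in> P" "?g v \<in> P"
        using fQ gP inj by (auto intro!: f_the_inv_into_f)
      with that arc show ?thesis by metis
    qed
    assume "(f x, f y) \<in> s"
    then have "(?g (f x), ?g (f y)) \<in> r"
      using fQ gP xy by (intro hasse_arc_preserving_imp_monotone[OF Q P(2) *]) auto
    then show "(x, y) \<in> r" using inj xy by (simp add: the_inv_into_f_f)
  qed
qed

section \<open>Finite posets, and intersection posets as an instance\<close>

theorem Z_series_eq_imp_poset_isomorphic:
  assumes H: "universal_graph H"
    and P: "finite P" "partial_order_on P r" and Q: "finite Q" "partial_order_on Q s"
    and eq: "Z_series H P r = Z_series H Q s"
  shows "poset_isomorphic P r Q s"
proof -
  let ?G = "hasse_graph P r" and ?G' = "hasse_graph Q s"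
  let ?w = "hasse_weight P r" and ?w' = "hasse_weight Q s"
  have V: "verts ?G = P" "verts ?G' = Q" by (simp_all add: hasse_graph_def)
  have G: "simple_graph ?G" "finite (verts ?G)" "\<And>v. v \<in> verts ?G \<Longrightarrow> ?w v \<ge> 1"
    using P V simple_graph_hasse_graph hasse_weight_ge_1 by auto
  have G': "simple_graph ?G'" "finite (verts ?G')" "\<And>v. v \<in> verts ?G' \<Longrightarrow> ?w' v \<ge> 1"
    using Q V simple_graph_hasse_graph hasse_weight_ge_1 by auto
  have X: "X_series H ?G ?w = X_series H ?G' ?w'"
    using eq by (simp add: Z_series_def)
  obtain \<psi> where \<psi>: "weighted_quotient_map ?G ?w ?G' ?w' \<psi>"
    using X_series_eq_imp_weighted_quotient_map[OF H G G' X] .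
  obtain \<psi>' where \<psi>': "weighted_quotient_map ?G' ?w' ?G ?w \<psi>'"
    using X_series_eq_imp_weighted_quotient_map[OF H G' G X[symmetric]] .
  note iso = mutual_weighted_quotient_maps_imp_isomorphism[OF G(1,2) G'(1,2) \<psi> \<psi>', unfolded V]
  show ?thesis
    using iso
    by (intro hasse_arc_isomorphism_imp_poset_isomorphic[OF P Q iso(1)])
      (simp add: hasse_arc_iff_edge_and_weight[OF P] hasse_arc_iff_edge_and_weight[OF Q])
qed

theorem mainTheorem4:
  fixes H :: "'h graph"
    and scale1 :: "'k1::field \<Rightarrow> 'v1::ab_group_add \<Rightarrow> 'v1" and Basis1 :: "'v1 set"
    and scale2 :: "'k2::field \<Rightarrow> 'v2::ab_group_add \<Rightarrow> 'v2" and Basis2 :: "'v2 set"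
    and \<A>1 :: "'v1 set set" and \<A>2 :: "'v2 set set"
  assumes "universal_graph H"
    and "finite_dimensional_vector_space scale1 Basis1"
    and "finite_dimensional_vector_space scale2 Basis2"
    and "finite_arrangement scale1 \<A>1"
    and "finite_arrangement scale2 \<A>2"
    and "\<not> poset_isomorphic (intersection_poset \<A>1) (intersection_order \<A>1)
                         (intersection_poset \<A>2) (intersection_order \<A>2)"
  shows "Z_series H (intersection_poset \<A>1) (intersection_order \<A>1)
       \<noteq> Z_series H (intersection_poset \<A>2) (intersection_order \<A>2)"
proof
  assume "Z_series H (intersection_poset \<A>1) (intersection_order \<A>1)
    = Z_series H (intersection_poset \<A>2) (intersection_order \<A>2)"
  moreover have "finite (intersection_poset \<A>1)" "finite (intersection_poset \<A>2)"
    using assms(4,5) by (simp_all add: finite_arrangement_def finite_intersection_poset)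
  ultimately show False
    using Z_series_eq_imp_poset_isomorphic[OF assms(1) _ partial_order_intersection_order
        _ partial_order_intersection_order] assms(6) by blast
qed

end
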